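(* Let $A\in\mathbb{R}^{m\times n}$, $b\in\mathbb{R}^m$, let $\beta>0$ and $\gamma\ge 0$ be given hyperparameters, and consider the problem of minimizing $$\Phi_{\beta,\gamma}(x,w)=F(x)+\beta\,G_\gamma(x,w),\qquad F(x)=\tfrac12\|Ax-b\|_2^2,\qquad G_\gamma(x,w)=\sum_{i=1}^n w_i|x_i|+\gamma\sum_{i=1}^n w_i\ln w_i,$$ subject to $w_i\ge 0$ for all $i$ and $\sum_{i=1}^n w_i=1$. For fixed $x=(x_1,\dots,x_n)\in\mathbb{R}^n$, the solution of this problem with respect to $w=(w_1,\dots,w_n)$ (obtained by the Lagrange multiplier method) is $$w_i=\frac{\exp\left(-\frac{|x_i|}{\gamma}\right)}{\sum_{l=1}^n\exp\left(-\frac{|x_l|}{\gamma}\right)},\qquad i=1,\dots,n,$$ and these weights satisfy the constraints $w_i\ge 0$ and $\sum_{i=1}^n w_i=1$.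
   Context: The model is solved by alternately updating $w$ (with $x$ fixed) and $x$ (with $w$ fixed); the statement is the update rule for $w$. Since $F(x)$ does not depend on $w$, the update for $w$ amounts to minimizing $G_\gamma(x,\cdot)$ under the constraints, using the Lagrange function $L(w,\lambda)=G_\gamma(x,w)+\lambda\left(\sum_{i=1}^n w_i-1\right)$ with multiplier $\lambda$ and setting its partial derivatives in $w_i$ and $\lambda$ to zero. The expression $w_i\ln w_i$ is read as $0$ when $w_i=0$.
   Formalization: The formal statement requires γ > 0 instead of γ ≥ 0, since the formula for the weights divides by γ and is undefined at γ = 0. *)

theory Defs
  imports "HOL-Analysis.Analysis"
begin

definition F :: "real^'n^'m \<Rightarrow> real^'m \<Rightarrow> real^'n \<Rightarrow> real" where
  "F A b x = (1/2) * (norm (A *v x - b))\<^sup>2"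

text \<open>The convention that w ln w is 0 at w = 0 holds automatically, since the factor w vanishes.\<close>

definition G :: "real \<Rightarrow> real^'n \<Rightarrow> real^'n \<Rightarrow> real" where
  "G \<gamma> x w = (\<Sum>i\<in>UNIV. w $ i * \<bar>x $ i\<bar>) + \<gamma> * (\<Sum>i\<in>UNIV. w $ i * ln (w $ i))"

definition Phi ::
  "real^'n^'m \<Rightarrow> real^'m \<Rightarrow> real \<Rightarrow> real \<Rightarrow> real^'n \<Rightarrow> real^'n \<Rightarrow> real" where
  "Phi A b \<beta> \<gamma> x w = F A b x + \<beta> * G \<gamma> x w"

definition feasible :: "real^'n \<Rightarrow> bool" where
  "feasible w \<longleftrightarrow> (\<forall>i. w $ i \<ge> 0) \<and> (\<Sum>i\<in>UNIV. w $ i) = 1"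

definition Lagr :: "real \<Rightarrow> real^'n \<Rightarrow> real^'n \<Rightarrow> real \<Rightarrow> real" where
  "Lagr \<gamma> x w l = G \<gamma> x w + l * ((\<Sum>i\<in>UNIV. w $ i) - 1)"

text \<open>
  All partial derivatives of the Lagrange function exist and vanish at (w, l). As a function of
  each w $ i it lives on the nonnegative reals, so these derivatives are taken within that set:
  for w $ i > 0 this is the ordinary derivative, and the values HOL gives to the logarithm of a
  negative number play no role. For w $ i < 0 the condition would be void, hence the requirement
  that w be nonnegative.
\<close>

definition Lagr_stationary :: "real \<Rightarrow> real^'n \<Rightarrow> real^'n \<Rightarrow> real \<Rightarrow> bool" where
  "Lagr_stationary \<gamma> x w l \<longleftrightarrow>
     (\<forall>i. w $ i \<ge> 0) \<and>
     (\<forall>i. ((\<lambda>t. Lagr \<gamma> x (\<chi> j. if j = i then t else w $ j) l)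
            has_real_derivative 0) (at (w $ i) within {0..})) \<and>
     ((\<lambda>m. Lagr \<gamma> x w m) has_real_derivative 0) (at l)"

definition weights :: "real \<Rightarrow> real^'n \<Rightarrow> real^'n" where
  "weights \<gamma> x = (\<chi> i. exp (- (\<bar>x $ i\<bar> / \<gamma>)) / (\<Sum>l\<in>UNIV. exp (- (\<bar>x $ l\<bar> / \<gamma>))))"

end

(*
  With Z the normalising sum and p the claimed weights, |x_i| = - gamma ln p_i - gamma ln Z, so on
  the simplex G(x, w) equals gamma times the relative entropy of w with respect to p, minus
  gamma ln Z. Gibbs' inequality then makes p the unique minimiser. For the Lagrange condition,
  t ln t has slope minus infinity at 0, which forces a stationary w to be positive; the equation
  ln w_i = - |x_i| / gamma + const and the constraint determine w.
*)
theory Submission imports Defs begin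

text \<open>For \<open>v > 0\<close> the gap between the two sides is
  \<open>v * (s - 1 - ln s)\<close> with \<open>s = q / v\<close>, so this is
  \<open>ln s \<le> s - 1\<close>, where equality forces \<open>s = 1\<close>. At
  \<open>v = 0\<close> the logarithms are multiplied by zero and \<open>q > 0\<close> settles both
  claims.\<close>

lemma mult_ln_diff_ge:
  fixes v q :: real
  assumes "v \<ge> 0" "q > 0"
  shows "v - q \<le> v * ln v - v * ln q"
    and "v * ln v - v * ln q = v - q \<longleftrightarrow> v = q"
proof -
  have *: "v - q \<le> v * ln v - v * ln q \<and> (v * ln v - v * ln q = v - q \<longleftrightarrow> v = q)"
  proof (cases "v = 0")
    case True
    then show ?thesis using assms by auto
  next
    case False
    with assms have v: "v > 0" by simp
    have d: "v * ln v - v * ln q - (v - q) = v * (q / v - 1 - ln (q / v))"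
      using v assms by (simp add: ln_div field_simps)
    have le: "ln (q / v) \<le> q / v - 1"
      using v assms by (intro ln_le_minus_one) simp
    have ge: "0 \<le> v * (q / v - 1 - ln (q / v))"
      using v le by simp
    have eq: "v = q" if "v * ln v - v * ln q = v - q"
    proof -
      have "ln (q / v) = q / v - 1" using d that v by simp
      then have "q / v = 1"
        using v assms by (intro ln_eq_minus_one) simp_all
      then show "v = q" using v by simp
    qed
    show ?thesis using d ge eq by auto
  qed
  show "v - q \<le> v * ln v - v * ln q" using * by blast
  show "v * ln v - v * ln q = v - q \<longleftrightarrow> v = q" using * by blast
qed

text \<open>Equal totals allow \<open>w i - p i\<close> to be subtracted from each summand without
  changing the sum. Every summand is then nonnegative by \<open>mult_ln_diff_ge\<close>, and the sum
  vanishes only if each summand does.\<close>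

lemma Gibbs_inequality:
  fixes w p :: "'n::finite \<Rightarrow> real"
  assumes "\<And>i. w i \<ge> 0" "\<And>i. p i > 0" "(\<Sum>i\<in>UNIV. w i) = (\<Sum>i\<in>UNIV. p i)"
  shows "(\<Sum>i\<in>UNIV. w i * ln (w i) - w i * ln (p i)) \<ge> 0"
    and "(\<Sum>i\<in>UNIV. w i * ln (w i) - w i * ln (p i)) = 0 \<longleftrightarrow> w = p"
proof -
  let ?d = "\<lambda>i. w i * ln (w i) - w i * ln (p i) - (w i - p i)"
  have nn: "?d i \<ge> 0" for i
    using mult_ln_diff_ge(1)[OF assms(1) assms(2), of i i] by simp
  have s: "(\<Sum>i\<in>UNIV. w i * ln (w i) - w i * ln (p i)) = (\<Sum>i\<in>UNIV. ?d i)"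
    using assms(3) by (simp add: sum_subtractf)
  show "(\<Sum>i\<in>UNIV. w i * ln (w i) - w i * ln (p i)) \<ge> 0"
    unfolding s by (intro sum_nonneg nn)
  have "(\<Sum>i\<in>UNIV. ?d i) = 0 \<longleftrightarrow> (\<forall>i. ?d i = 0)"
    using nn by (subst sum_nonneg_eq_0_iff) auto
  also have "\<dots> \<longleftrightarrow> (\<forall>i. w i = p i)"
    using mult_ln_diff_ge(2)[OF assms(1) assms(2)] by simp
  finally show "(\<Sum>i\<in>UNIV. w i * ln (w i) - w i * ln (p i)) = 0 \<longleftrightarrow> w = p"
    unfolding s by auto
qed

lemma exp_sum_pos: "(\<Sum>l\<in>UNIV. exp (f l :: real)) > 0" for f :: "'n::finite \<Rightarrow> real"
  by (intro sum_pos) auto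

lemma weights_pos: "weights \<gamma> x $ i > 0"
  unfolding weights_def by (simp add: exp_sum_pos)

lemma sum_weights: "(\<Sum>i\<in>UNIV. weights \<gamma> x $ i) = 1"
  unfolding weights_def using exp_sum_pos[of "\<lambda>l. - (\<bar>x $ l\<bar> / \<gamma>)"]
  by (simp flip: sum_divide_distrib)

lemma ln_weights:
  "ln (weights \<gamma> x $ i) = - (\<bar>x $ i\<bar> / \<gamma>) - ln (\<Sum>l\<in>UNIV. exp (- (\<bar>x $ l\<bar> / \<gamma>)))"
  unfolding weights_def using exp_sum_pos[of "\<lambda>l. - (\<bar>x $ l\<bar> / \<gamma>)"]
  by (simp add: ln_div)

lemma feasible_weights: "feasible (weights \<gamma> x)"
  unfolding feasible_def using sum_weights less_imp_le[OF weights_pos] by blast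

lemma G_eq_relative_entropy:
  assumes "\<gamma> \<noteq> 0" "(\<Sum>i\<in>UNIV. w $ i) = 1"
  shows "G \<gamma> x w = \<gamma> * (\<Sum>i\<in>UNIV. w $ i * ln (w $ i) - w $ i * ln (weights \<gamma> x $ i))
    - \<gamma> * ln (\<Sum>l\<in>UNIV. exp (- (\<bar>x $ l\<bar> / \<gamma>)))"
proof -
  define c where "c = ln (\<Sum>l\<in>UNIV. exp (- (\<bar>x $ l\<bar> / \<gamma>)))"
  have "\<bar>x $ i\<bar> = - \<gamma> * ln (weights \<gamma> x $ i) - \<gamma> * c" for i
    using assms(1) unfolding ln_weights c_def by (simp add: field_simps)
  then have "(\<Sum>i\<in>UNIV. w $ i * \<bar>x $ i\<bar>)
      = (\<Sum>i\<in>UNIV. w $ i * (- \<gamma> * ln (weights \<gamma> x $ i) - \<gamma> * c))"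
    by simp
  also have "\<dots> = - \<gamma> * (\<Sum>i\<in>UNIV. w $ i * ln (weights \<gamma> x $ i)) - \<gamma> * c * (\<Sum>i\<in>UNIV. w $ i)"
    by (simp add: sum_distrib_left sum_subtractf sum_negf algebra_simps)
  finally show ?thesis
    using assms(2) by (simp add: G_def sum_subtractf algebra_simps flip: c_def)
qed

lemma weights_minimize_G:
  assumes "\<gamma> > 0" "feasible w"
  shows "G \<gamma> x (weights \<gamma> x) \<le> G \<gamma> x w"
    and "G \<gamma> x w = G \<gamma> x (weights \<gamma> x) \<longleftrightarrow> w = weights \<gamma> x"
proof -
  let ?D = "\<Sum>i\<in>UNIV. w $ i * ln (w $ i) - w $ i * ln (weights \<gamma> x $ i)"
  have w: "\<And>i. w $ i \<ge> 0" "(\<Sum>i\<in>UNIV. w $ i) = 1"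
    using assms(2) by (auto simp: feasible_def)
  \<comment> \<open>\<open>G_eq_relative_entropy\<close> is applied to both \<open>w\<close> and the
    weights; the weights have relative entropy 0 to themselves, and the normalising constant
    cancels.\<close>
  have diff: "G \<gamma> x w = \<gamma> * ?D + G \<gamma> x (weights \<gamma> x)"
    using assms(1) w(2) by (simp add: G_eq_relative_entropy sum_weights)
  have "?D \<ge> 0"
    using w by (intro Gibbs_inequality) (auto simp: weights_pos sum_weights)
  then show "G \<gamma> x (weights \<gamma> x) \<le> G \<gamma> x w"
    using assms(1) diff by simp
  have "?D = 0 \<longleftrightarrow> ($) w = ($) (weights \<gamma> x)"
    using w by (intro Gibbs_inequality) (auto simp: weights_pos sum_weights)
  then show "G \<gamma> x w = G \<gamma> x (weights \<gamma> x) \<longleftrightarrow> w = weights \<gamma> x"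
    using assms(1) diff by (auto simp: vec_eq_iff fun_eq_iff)
qed

lemma is_arg_min_Phi_iff:
  assumes "\<beta> > 0" "\<gamma> > 0"
  shows "is_arg_min (Phi A b \<beta> \<gamma> x) feasible w \<longleftrightarrow> w = weights \<gamma> x"
proof
  assume m: "is_arg_min (Phi A b \<beta> \<gamma> x) feasible w"
  then have "feasible w" "Phi A b \<beta> \<gamma> x w \<le> Phi A b \<beta> \<gamma> x (weights \<gamma> x)"
    using feasible_weights by (auto simp: is_arg_min_linorder)
  then have "G \<gamma> x w \<le> G \<gamma> x (weights \<gamma> x)"
    using assms(1) by (simp add: Phi_def)
  then show "w = weights \<gamma> x"
    using weights_minimize_G[OF assms(2) \<open>feasible w\<close>] by (meson order_antisym)
next
  assume "w = weights \<gamma> x"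
  then show "is_arg_min (Phi A b \<beta> \<gamma> x) feasible w"
    using assms weights_minimize_G(1)[OF assms(2)] feasible_weights
    by (auto simp: is_arg_min_linorder Phi_def)
qed

text \<open>This is the shape of the Lagrange function in a single coordinate. At a positive point
  the slope is the expression on the right; at 0 the difference quotient is
  \<open>c + \<gamma> * ln t\<close>, which is unbounded below as \<open>t\<close> tends to
  0.\<close>

lemma has_derivative_zero_mult_ln_iff:
  fixes \<gamma> v c C :: real
  assumes "\<gamma> > 0" "v \<ge> 0"
  shows "((\<lambda>t. t * (c + \<gamma> * ln t) + C) has_real_derivative 0) (at v within {0..})
    \<longleftrightarrow> v > 0 \<and> c + \<gamma> * ln v + \<gamma> = 0"
proof (cases "v = 0")
  case True
  have "\<not> ((\<lambda>t. t * (c + \<gamma> * ln t) + C) has_real_derivative 0) (at 0 within {0..})"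
  proof
    assume "((\<lambda>t. t * (c + \<gamma> * ln t) + C) has_real_derivative 0) (at 0 within {0..})"
    then have "((\<lambda>t. (t * (c + \<gamma> * ln t)) / t) \<longlongrightarrow> 0) (at_right 0)"
      by (simp add: has_field_derivative_iff at_within_Ici_at_right)
    moreover have "eventually (\<lambda>t. (t * (c + \<gamma> * ln t)) / t = c + \<gamma> * ln t) (at_right (0::real))"
      using eventually_at_right_less[of "0::real"] by eventually_elim simp
    ultimately have "((\<lambda>t. c + \<gamma> * ln t) \<longlongrightarrow> 0) (at_right 0)"
      by (rule Lim_transform_eventually)
    \<comment> \<open>Undoing the affine map isolates \<open>ln\<close>, which would then have a
      finite limit at 0.\<close>
    then have "((\<lambda>t. ((c + \<gamma> * ln t) - c) / \<gamma>) \<longlongrightarrow> (0 - c) / \<gamma>) (at_right 0)"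
      using assms by (intro tendsto_intros) auto
    then have "(ln \<longlongrightarrow> - c / \<gamma>) (at_right (0::real))"
      using assms by simp
    then show False
      using not_tendsto_and_filterlim_at_infinity[of "at_right (0::real)" ln]
        filterlim_at_bot_imp_at_infinity[OF ln_at_0] by auto
  qed
  then show ?thesis using True by simp
next
  case False
  with assms have v: "v > 0" by simp
  \<comment> \<open>A positive \<open>v\<close> is interior to the half-line, so uniqueness of the
    ordinary derivative becomes available.\<close>
  have "at v within {0..} = at v"
    using v by (intro at_within_interior) simp
  moreover have d: "((\<lambda>t. t * (c + \<gamma> * ln t) + C) has_real_derivative (c + \<gamma> * ln v + \<gamma>)) (at v)"
    using v by (auto intro!: derivative_eq_intros)
  ultimately show ?thesis
    using v DERIV_unique[OF d, of 0] by auto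
qed

text \<open>The Lagrange function is separable, so only the \<open>i\<close>-th summands involve
  \<open>t\<close>. The remainder can be written as the value at \<open>t = 0\<close>, because the
  \<open>t\<close>-dependent term is zero there.\<close>

lemma Lagr_slice:
  "Lagr \<gamma> x (\<chi> j. if j = i then t else w $ j) l
    = t * ((\<bar>x $ i\<bar> + l) + \<gamma> * ln t)
      + Lagr \<gamma> x (\<chi> j. if j = i then 0 else w $ j) l"
proof -
  \<comment> \<open>A general \<open>h\<close> covers the linear, entropy and constraint sums
    alike.\<close>
  have split: "(\<Sum>j\<in>UNIV. h j (if j = i then s else w $ j))
      = h i s + (\<Sum>j\<in>UNIV - {i}. h j (w $ j))" for h :: "'a \<Rightarrow> real \<Rightarrow> real" and s
    by (subst sum.remove[of _ i]) (auto intro!: sum.cong)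
  show ?thesis
    using split[of "\<lambda>j s. s * \<bar>x $ j\<bar>"] split[of "\<lambda>_ s. s * ln s"] split[of "\<lambda>_ s. s"]
    by (simp add: Lagr_def G_def algebra_simps)
qed

text \<open>In the multiplier the function is affine with the constraint residual as slope. In each
  coordinate the slice has \<open>c = \<bar>x $ i\<bar> + l\<close>.\<close>

lemma Lagr_stationary_iff:
  assumes "\<gamma> > 0"
  shows "Lagr_stationary \<gamma> x w l \<longleftrightarrow>
    (\<forall>i. w $ i > 0 \<and> \<bar>x $ i\<bar> + l + \<gamma> * ln (w $ i) + \<gamma> = 0) \<and> (\<Sum>i\<in>UNIV. w $ i) = 1"
proof -
  have d: "((\<lambda>m. Lagr \<gamma> x w m) has_real_derivative ((\<Sum>i\<in>UNIV. w $ i) - 1)) (at l)"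
    unfolding Lagr_def by (auto intro!: derivative_eq_intros)
  then have m: "((\<lambda>m. Lagr \<gamma> x w m) has_real_derivative 0) (at l) \<longleftrightarrow> (\<Sum>i\<in>UNIV. w $ i) = 1"
    using DERIV_unique[OF d, of 0] by auto
  have "((\<lambda>t. Lagr \<gamma> x (\<chi> j. if j = i then t else w $ j) l) has_real_derivative 0)
        (at (w $ i) within {0..})
      \<longleftrightarrow> w $ i > 0 \<and> \<bar>x $ i\<bar> + l + \<gamma> * ln (w $ i) + \<gamma> = 0" if "w $ i \<ge> 0" for i
    by (subst Lagr_slice) (rule has_derivative_zero_mult_ln_iff[OF assms that])
  then show ?thesis
    unfolding Lagr_stationary_def m using less_imp_le by blast
qed

lemma ex_Lagr_stationary_iff:
  assumes "\<gamma> > 0"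
  shows "(\<exists>l. Lagr_stationary \<gamma> x w l) \<longleftrightarrow> w = weights \<gamma> x"
proof
  let ?Z = "\<Sum>l\<in>UNIV. exp (- (\<bar>x $ l\<bar> / \<gamma>))"
  assume "\<exists>l. Lagr_stationary \<gamma> x w l"
  then obtain l where w: "\<And>i. w $ i > 0" "\<And>i. \<bar>x $ i\<bar> + l + \<gamma> * ln (w $ i) + \<gamma> = 0"
    and s: "(\<Sum>i\<in>UNIV. w $ i) = 1"
    unfolding Lagr_stationary_iff[OF assms] by blast
  \<comment> \<open>Solving the stationarity equation for \<open>w $ i\<close> leaves this factor,
    which is independent of \<open>i\<close>; the constraint then forces it to be
    \<open>1 / ?Z\<close>.\<close>
  define c where "c = exp (- (l / \<gamma>) - 1)"
  have wi: "w $ i = exp (- (\<bar>x $ i\<bar> / \<gamma>)) * c" for i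
  proof -
    have "ln (w $ i) = - (\<bar>x $ i\<bar> / \<gamma>) + (- (l / \<gamma>) - 1)"
    proof -
      have "\<gamma> * ln (w $ i) = - \<bar>x $ i\<bar> - l - \<gamma>"
        using w(2)[of i] by simp
      then have "ln (w $ i) = (- \<bar>x $ i\<bar> - l - \<gamma>) / \<gamma>"
        using assms by (simp add: eq_divide_eq mult.commute)
      then show ?thesis
        using assms by (simp add: diff_divide_distrib)
    qed
    then have "exp (ln (w $ i)) = exp (- (\<bar>x $ i\<bar> / \<gamma>)) * c"
      by (simp only: exp_add c_def)
    then show ?thesis using w(1)[of i] by simp
  qed
  have "?Z * c = 1"
    using s unfolding wi by (simp add: sum_distrib_right)
  then have "c = 1 / ?Z"
    using exp_sum_pos[of "\<lambda>l. - (\<bar>x $ l\<bar> / \<gamma>)"] by (simp add: eq_divide_eq mult.commute)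
  then show "w = weights \<gamma> x"
    by (simp add: vec_eq_iff wi weights_def)
next
  let ?Z = "\<Sum>l\<in>UNIV. exp (- (\<bar>x $ l\<bar> / \<gamma>))"
  assume "w = weights \<gamma> x"
  \<comment> \<open>Substituting \<open>ln_weights\<close> into the coordinate equation cancels
    \<open>\<bar>x $ i\<bar>\<close> and leaves \<open>l - \<gamma> * ln ?Z + \<gamma> = 0\<close>,
    which gives this multiplier.\<close>
  then have "Lagr_stationary \<gamma> x w (\<gamma> * ln ?Z - \<gamma>)"
    using assms unfolding Lagr_stationary_iff[OF assms]
    by (simp add: weights_pos sum_weights ln_weights right_diff_distrib)
  then show "\<exists>l. Lagr_stationary \<gamma> x w l" ..
qed

theorem mainTheorem2:
  fixes A :: "real^'n^'m" and b :: "real^'m" and \<beta> \<gamma> :: real and x :: "real^'n"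
  assumes "\<beta> > 0" and "\<gamma> \<ge> 0"
    and "\<gamma> \<noteq> 0" (* the weight formula divides by \<gamma> *)
  shows "(\<forall>w. is_arg_min (Phi A b \<beta> \<gamma> x) feasible w \<longleftrightarrow> w = weights \<gamma> x) \<and>
    (\<forall>w. (\<exists>l. Lagr_stationary \<gamma> x w l) \<longleftrightarrow> w = weights \<gamma> x) \<and>
    (\<forall>i. weights \<gamma> x $ i \<ge> 0) \<and> (\<Sum>i\<in>UNIV. weights \<gamma> x $ i) = 1"
proof -
  have "\<gamma> > 0" using assms by simp
  with assms(1) show ?thesis
    by (simp add: is_arg_min_Phi_iff ex_Lagr_stationary_iff sum_weights less_imp_le[OF weights_pos])
qed

end
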